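(* Let $t>0$ be a real number, and let $\varphi\colon \Lambda_{\mathbb{R}}\rightarrow \mathbb{R}$ be the homomorphism of $\mathbb{R}$-algebras determined by $$\varphi(h_n)=\frac{1}{(t)_n\, n!}\qquad (n\geq 0),$$ where $h_n$ is the $n$-th complete symmetric function and $(t)_n=t(t+1)\cdots(t+n-1)$. Then for every skew partition $\lambda/\mu$, the value $\varphi(s_{\lambda/\mu})$ of $\varphi$ at the skew Schur function $s_{\lambda/\mu}$ is (strictly) positive.
   Context: $\Lambda_{\mathbb{R}}$ denotes the algebra of symmetric functions with real coefficients. It is generated by the complete symmetric functions $h_n$, with $h_0=1$ and $h_1,h_2,\ldots$ algebraically independent, so an $\mathbb{R}$-algebra homomorphism $\varphi\colon\Lambda_{\mathbb{R}}\to\mathbb{R}$ is uniquely determined by the values $\varphi(h_n)$. The rising factorial is $(t)_n=t(t+1)\cdots(t+n-1)$, with $(t)_0=1$. An integer partition is a weakly decreasing sequence $\lambda=(\lambda_1,\lambda_2,\ldots,\lambda_\ell)$ of nonnegative integers. A skew partition $\lambda/\mu$ is a pair $(\lambda,\mu)$ of partitions of the same length $\ell$ (zero parts being allowed) such that $\mu_i\leq\lambda_i$ for each $1\leq i\leq \ell$. The skew Schur function indexed by $\lambda/\mu$ is given by the Jacobi-Trudi identity $$s_{\lambda/\mu}=\det\left(h_{\lambda_i-\mu_j-i+j}\right)_{i,j=1}^{\ell},$$ where $h_k$ is set to be $0$ if $k<0$. When $\mu$ is the empty partition (all parts zero), $s_{\lambda/\mu}$ is the Schur function $s_\lambda$.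 *)

theory Defs
  imports Complex_Main "HOL-Library.Multiset" "Jordan_Normal_Form.Determinant"
begin

text \<open>
  A monomial in the variables \<open>x\<^sub>0, x\<^sub>1, x\<^sub>2, \<dots>\<close> is represented by the multiset of the indices of
  its variables, so that the product of monomials is the union \<open>+\<close> and the degree is \<open>size\<close>.
  A symmetric function is a formal power series, given by its coefficients, that has bounded
  degree and is invariant under permutations of the variables.
\<close>

typedef symfun =
  "{f :: nat multiset \<Rightarrow> real.
      (\<exists>d. \<forall>m. d < size m \<longrightarrow> f m = 0) \<and>
      (\<forall>p m. bij p \<longrightarrow> f (image_mset p m) = f m)}"
  morphisms sf_coeff Abs_symfun
  by (rule exI[of _ "\<lambda>_. 0"]) simp

setup_lifting type_definition_symfun

lemma finite_mset_splits: "finite {(a, b). a + b = (m :: 'a multiset)}"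
proof (rule finite_subset)
  show "{(a, b). a + b = m} \<subseteq> (\<lambda>a. (a, m - a)) ` {a. a \<subseteq># m}"
    by auto
  have "{a. a \<subseteq># m} \<subseteq> {a. set_mset a \<subseteq> set_mset m \<and> size a \<le> size m}"
    by (auto dest: set_mset_mono size_mset_mono)
  moreover have "finite {a. set_mset a \<subseteq> set_mset m \<and> size a \<le> size m}"
  proof (rule finite_subset)
    show "{a. set_mset a \<subseteq> set_mset m \<and> size a \<le> size m}
      \<subseteq> mset ` {xs. set xs \<subseteq> set_mset m \<and> length xs \<le> size m}"
    proof
      fix a assume a: "a \<in> {a. set_mset a \<subseteq> set_mset m \<and> size a \<le> size m}"
      obtain xs where "mset xs = a" using ex_mset by blast
      with a show "a \<in> mset ` {xs. set xs \<subseteq> set_mset m \<and> length xs \<le> size m}"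
        by auto
    qed
    show "finite (mset ` {xs. set xs \<subseteq> set_mset m \<and> length xs \<le> size m})"
      by (intro finite_imageI finite_lists_length_le) simp
  qed
  ultimately show "finite ((\<lambda>a. (a, m - a)) ` {a. a \<subseteq># m})"
    by (meson finite_imageI finite_subset)
qed

definition mset_conv :: "(nat multiset \<Rightarrow> real) \<Rightarrow> (nat multiset \<Rightarrow> real) \<Rightarrow> nat multiset \<Rightarrow> real"
  where "mset_conv f g m = (\<Sum>(a, b) | a + b = m. f a * g b)"

lemma mset_conv_permute:
  assumes p: "bij p"
    and f: "\<And>m. f (image_mset p m) = f m" and g: "\<And>m. g (image_mset p m) = g m"
  shows "mset_conv f g (image_mset p m) = mset_conv f g m"
proof -
  let ?P = "image_mset p" and ?Q = "image_mset (inv_into UNIV p)"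
  have pq: "?P (?Q x) = x" and qp: "?Q (?P x) = x" for x
    using p by (simp_all add: multiset.map_comp bij_is_surj bij_is_inj surj_iff[symmetric] o_def
        surj_f_inv_f inv_f_f)
  have "(\<Sum>(a, b) | a + b = m. f a * g b) = (\<Sum>(a, b) | a + b = ?P m. f a * g b)"
    by (rule sum.reindex_bij_witness[where i = "\<lambda>(a, b). (?Q a, ?Q b)" and j = "\<lambda>(a, b). (?P a, ?P b)"])
      (auto simp: pq qp f g simp flip: image_mset_union)
  then show ?thesis by (simp add: mset_conv_def)
qed

lemma finite_mset_splits': "finite {p. fst p + snd p = (m :: 'a multiset)}"
  using finite_mset_splits[of m] by (simp add: case_prod_unfold)

lemma mset_conv_commute: "mset_conv f g m = mset_conv g f m"
  unfolding mset_conv_def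
  by (rule sum.reindex_bij_witness[where i = prod.swap and j = prod.swap])
    (auto simp: add.commute)

lemma mset_conv_assoc: "mset_conv (mset_conv f g) h m = mset_conv f (mset_conv g h) m"
proof -
  have "mset_conv (mset_conv f g) h m
      = (\<Sum>x\<in>{(a, b). a + b = m}. \<Sum>y\<in>{(c, d). c + d = fst x}. f (fst y) * g (snd y) * h (snd x))"
    by (simp add: mset_conv_def sum_distrib_right case_prod_unfold)
  also have "\<dots> = (\<Sum>z\<in>Sigma {(a, b). a + b = m} (\<lambda>x. {(c, d). c + d = fst x}).
      f (fst (snd z)) * g (snd (snd z)) * h (snd (fst z)))"
    by (subst sum.Sigma) (auto simp: finite_mset_splits' case_prod_unfold)
  also have "\<dots> = (\<Sum>z\<in>Sigma {(a, b). a + b = m} (\<lambda>x. {(c, d). c + d = snd x}).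
      f (fst (fst z)) * (g (fst (snd z)) * h (snd (snd z))))"
    by (rule sum.reindex_bij_witness[where
          i = "\<lambda>((a, b), (c, d)). ((a + c, d), (a, c))" and
          j = "\<lambda>((a, b), (c, d)). ((c, d + b), (d, b))"]) (auto simp: ac_simps)
  also have "\<dots> = (\<Sum>x\<in>{(a, b). a + b = m}. \<Sum>y\<in>{(c, d). c + d = snd x}.
      f (fst x) * (g (fst y) * h (snd y)))"
    by (subst sum.Sigma) (auto simp: finite_mset_splits' case_prod_unfold)
  also have "\<dots> = mset_conv f (mset_conv g h) m"
    by (simp add: mset_conv_def sum_distrib_left case_prod_unfold)
  finally show ?thesis .
qed

lemma mset_conv_unit: "mset_conv (\<lambda>m. if m = {#} then 1 else 0) f m = f m"
proof -
  have "mset_conv (\<lambda>m. if m = {#} then 1 else 0) f m = (\<Sum>(a, b) \<in> {({#} :: nat multiset, m)}. f b)"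
    unfolding mset_conv_def
    by (intro sum.mono_neutral_cong_right) (auto simp: finite_mset_splits split: if_splits)
  then show ?thesis by simp
qed

instantiation symfun :: comm_ring_1
begin

lift_definition zero_symfun :: symfun is "\<lambda>_. 0" by simp

lift_definition one_symfun :: symfun is "\<lambda>m. if m = {#} then 1 else 0"
  by (auto intro: exI[of _ 0])

lift_definition plus_symfun :: "symfun \<Rightarrow> symfun \<Rightarrow> symfun" is "\<lambda>f g m. f m + g m"
proof (intro conjI; elim conjE exE)
  fix f g :: "nat multiset \<Rightarrow> real" and d e
  assume "\<forall>m. d < size m \<longrightarrow> f m = 0" "\<forall>m. e < size m \<longrightarrow> g m = 0"
  then show "\<exists>d. \<forall>m. d < size m \<longrightarrow> f m + g m = 0"
    by (intro exI[of _ "max d e"]) simp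
qed simp

lift_definition uminus_symfun :: "symfun \<Rightarrow> symfun" is "\<lambda>f m. - f m"
  by simp

definition minus_symfun :: "symfun \<Rightarrow> symfun \<Rightarrow> symfun" where
  "minus_symfun f g = f + - g"

lift_definition times_symfun :: "symfun \<Rightarrow> symfun \<Rightarrow> symfun" is mset_conv
proof (intro conjI; elim conjE exE)
  fix f g :: "nat multiset \<Rightarrow> real" and d e
  assume fg: "\<forall>m. d < size m \<longrightarrow> f m = 0" "\<forall>m. e < size m \<longrightarrow> g m = 0"
  have "mset_conv f g m = 0" if "d + e < size m" for m
    unfolding mset_conv_def
  proof (intro sum.neutral ballI, clarify)
    fix a b assume "m = a + b"
    with that have "d < size a \<or> e < size b" by auto
    with fg show "f a * g b = 0" by auto
  qed
  then show "\<exists>d. \<forall>m. d < size m \<longrightarrow> mset_conv f g m = 0" by blast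
qed (simp add: mset_conv_permute)

instance
proof
  fix f g h :: symfun
  show "f * g * h = f * (g * h)" by transfer (simp add: fun_eq_iff mset_conv_assoc)
  show "f * g = g * f" by transfer (simp add: fun_eq_iff mset_conv_commute)
  show "1 * f = f" by transfer (simp add: fun_eq_iff mset_conv_unit)
  show "(f + g) * h = f * h + g * h"
    by transfer (simp add: fun_eq_iff mset_conv_def case_prod_unfold distrib_right sum.distrib)
  show "(0 :: symfun) \<noteq> 1" by transfer (auto simp: fun_eq_iff)
  show "f + g + h = f + (g + h)" by transfer (simp add: fun_eq_iff)
  show "f + g = g + f" by transfer (simp add: fun_eq_iff)
  show "0 + f = f" by transfer simp
  show "- f + f = 0" by transfer simp
  show "f - g = f + - g" by (simp add: minus_symfun_def)
qed

end

instantiation symfun :: real_algebra_1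
begin

lift_definition scaleR_symfun :: "real \<Rightarrow> symfun \<Rightarrow> symfun" is "\<lambda>c f m. c * f m"
  by auto

instance
proof
  fix f g :: symfun and a b :: real
  show "a *\<^sub>R (f + g) = a *\<^sub>R f + a *\<^sub>R g" by transfer (simp add: fun_eq_iff distrib_left)
  show "(a + b) *\<^sub>R f = a *\<^sub>R f + b *\<^sub>R f" by transfer (simp add: fun_eq_iff distrib_right)
  show "a *\<^sub>R b *\<^sub>R f = (a * b) *\<^sub>R f" by transfer (simp add: fun_eq_iff)
  show "1 *\<^sub>R f = f" by transfer simp
  show "a *\<^sub>R f * g = a *\<^sub>R (f * g)"
    by transfer (simp add: fun_eq_iff mset_conv_def sum_distrib_left case_prod_unfold mult_ac)
  show "f * a *\<^sub>R g = a *\<^sub>R (f * g)"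
    by transfer (simp add: fun_eq_iff mset_conv_def sum_distrib_left case_prod_unfold mult_ac)
qed

end

lift_definition complete_sym :: "nat \<Rightarrow> symfun" is "\<lambda>n m. if size m = n then 1 else 0"
  by auto

lemma complete_sym_0: "complete_sym 0 = 1"
  by transfer (simp add: fun_eq_iff)

definition complete_sym_int :: "int \<Rightarrow> symfun" where
  "complete_sym_int k = (if k < 0 then 0 else complete_sym (nat k))"

definition is_partition :: "nat list \<Rightarrow> bool" where
  "is_partition lam \<longleftrightarrow> sorted_wrt (\<ge>) lam"

definition is_skew_partition :: "nat list \<Rightarrow> nat list \<Rightarrow> bool" where
  "is_skew_partition lam mu \<longleftrightarrow> is_partition lam \<and> is_partition mu \<and> length mu = length lam \<and>
     (\<forall>i < length lam. mu ! i \<le> lam ! i)"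

text \<open>
  The Jacobi-Trudi determinant; list indices start at \<open>0\<close>, which does not affect \<open>j - i\<close>.
\<close>

definition skew_schur :: "nat list \<Rightarrow> nat list \<Rightarrow> symfun" where
  "skew_schur lam mu =
     det (mat (length lam) (length lam)
       (\<lambda>(i, j). complete_sym_int (int (lam ! i) - int (mu ! j) - int i + int j)))"

definition real_algebra_hom :: "('a :: real_algebra_1 \<Rightarrow> 'b :: real_algebra_1) \<Rightarrow> bool" where
  "real_algebra_hom \<phi> \<longleftrightarrow> linear \<phi> \<and> \<phi> 1 = 1 \<and> (\<forall>x y. \<phi> (x * y) = \<phi> x * \<phi> y)"

end

theory Submission imports Defs begin

text \<open>
  Let \<open>H t\<close> be the generating function of the numbers \<open>1 / (pochhammer t n * fact n)\<close>. The contiguity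
  relation \<open>H t = H (t + 1) + z / (t (t + 1)) * H (t + 2)\<close> writes the Hurwitz matrix with the rows
  \<open>H (t + 1), H t, z H (t + 1), z H t, \<dots>\<close> as a nonnegative bidiagonal matrix times the Hurwitz
  matrix for \<open>t + 1\<close>. Starting from the truncations of the resulting continued fraction and passing
  to the limit shows that this matrix is totally nonnegative. A value of a skew Schur function is a
  minor that only uses rows \<open>z\<^sup>s H t\<close>. Expanding it with the contiguity relation and dropping
  nonnegative terms bounds it below by a positive multiple of a minor for \<open>t + 2\<close> in which
  one \<open>s\<close> has increased by one, that is, one box of the skew shape has been removed. When no box is
  left the minor is unitriangular.
\<close>

section \<open>Minors of infinite matrices and their multilinear expansion\<close>

definition minor :: "(nat \<Rightarrow> nat \<Rightarrow> real) \<Rightarrow> nat \<Rightarrow> (nat \<Rightarrow> nat) \<Rightarrow> (nat \<Rightarrow> nat) \<Rightarrow> real" where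
  "minor R r i j = det (mat r r (\<lambda>(a, b). R (i a) (j b)))"

lemma minor_Leibniz:
  "minor R r i j = (\<Sum>p | p permutes {0..<r}. signof p * (\<Prod>a\<in>{0..<r}. R (i a) (j (p a))))"
proof -
  have "minor R r i j = (\<Sum>p | p permutes {0..<r}.
      signof p * (\<Prod>a\<in>{0..<r}. mat r r (\<lambda>(a, b). R (i a) (j b)) $$ (a, p a)))"
    unfolding minor_def by (rule det_def') simp
  also have "\<dots> = (\<Sum>p | p permutes {0..<r}. signof p * (\<Prod>a\<in>{0..<r}. R (i a) (j (p a))))"
    by (intro sum.cong refl arg_cong2[where f = "(*)"] prod.cong) auto
  finally show ?thesis .
qed

text \<open>Multilinearity of the determinant in its rows; \<open>S\<close> collects the positions
  where the second summand is chosen.\<close>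

lemma minor_expand:
  assumes R: "\<And>i c. R i c = R' (lo i) c + w i * R' (hi i) c"
  shows "minor R r i j = (\<Sum>S\<in>Pow {0..<r}. (\<Prod>a\<in>S. w (i a)) *
    minor R' r (\<lambda>a. if a \<in> S then hi (i a) else lo (i a)) j)"
proof -
  have "minor R r i j = (\<Sum>p | p permutes {0..<r}. \<Sum>S\<in>Pow {0..<r}. signof p * ((\<Prod>a\<in>S. w (i a)) *
      (\<Prod>a\<in>{0..<r}. R' (if a \<in> S then hi (i a) else lo (i a)) (j (p a)))))"
    unfolding minor_Leibniz
  proof (intro sum.cong refl)
    fix p
    have *: "(\<Prod>a\<in>S. w (i a) * R' (hi (i a)) (j (p a))) * (\<Prod>a\<in>{0..<r} - S. R' (lo (i a)) (j (p a)))
      = (\<Prod>a\<in>S. w (i a)) * (\<Prod>a\<in>{0..<r}. R' (if a \<in> S then hi (i a) else lo (i a)) (j (p a)))"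
      if S: "S \<in> Pow {0..<r}" for S
    proof -
      let ?F = "\<lambda>a. R' (if a \<in> S then hi (i a) else lo (i a)) (j (p a))"
      have "prod ?F {0..<r} = prod ?F ({0..<r} - S) * prod ?F S"
        using S by (intro prod.subset_diff) auto
      then show ?thesis by (simp add: prod.distrib)
    qed
    have "(\<Prod>a\<in>{0..<r}. R (i a) (j (p a))) =
        (\<Prod>a\<in>{0..<r}. w (i a) * R' (hi (i a)) (j (p a)) + R' (lo (i a)) (j (p a)))"
      by (simp add: R add.commute)
    also have "\<dots> = (\<Sum>S\<in>Pow {0..<r}. (\<Prod>a\<in>S. w (i a)) *
        (\<Prod>a\<in>{0..<r}. R' (if a \<in> S then hi (i a) else lo (i a)) (j (p a))))"
      by (subst prod_add) (auto intro!: sum.cong simp del: Pow_iff simp: *)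
    finally show "signof p * (\<Prod>a\<in>{0..<r}. R (i a) (j (p a))) =
      (\<Sum>S\<in>Pow {0..<r}. signof p * ((\<Prod>a\<in>S. w (i a)) *
        (\<Prod>a\<in>{0..<r}. R' (if a \<in> S then hi (i a) else lo (i a)) (j (p a)))))"
      by (simp add: sum_distrib_left)
  qed
  also have "\<dots> = (\<Sum>S\<in>Pow {0..<r}. \<Sum>p | p permutes {0..<r}. signof p * ((\<Prod>a\<in>S. w (i a)) *
      (\<Prod>a\<in>{0..<r}. R' (if a \<in> S then hi (i a) else lo (i a)) (j (p a)))))"
    by (rule sum.swap)
  finally show ?thesis
    by (simp add: minor_Leibniz sum_distrib_left mult_ac)
qed

lemma minor_eq_rows:
  assumes "a < r" "b < r" "a \<noteq> b" "\<And>c. R (i a) c = R (i b) c"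
  shows "minor R r i j = 0"
  unfolding minor_def
  by (rule det_identical_rows[of _ r a b]) (use assms in \<open>auto intro!: eq_vecI\<close>)

lemma minor_zero_row:
  assumes "a < r" "\<And>b. b < r \<Longrightarrow> R (i a) (j b) = 0"
  shows "minor R r i j = 0"
  unfolding minor_Leibniz
proof (intro sum.neutral ballI)
  fix p assume "p \<in> {p. p permutes {0..<r}}"
  then have "p a < r" using assms(1) permutes_in_image[of p "{0..<r}" a] by auto
  then have "(\<Prod>a\<in>{0..<r}. R (i a) (j (p a))) = 0"
    using assms by (intro prod_zero bexI[of _ a]) auto
  then show "signof p * (\<Prod>a\<in>{0..<r}. R (i a) (j (p a))) = 0" by simp
qed

lemma minor_zero_col:
  assumes "b < r" "\<And>a. a < r \<Longrightarrow> R (i a) (j b) = 0"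
  shows "minor R r i j = 0"
  unfolding minor_Leibniz
proof (intro sum.neutral ballI)
  fix p assume "p \<in> {p. p permutes {0..<r}}"
  then have p: "p permutes {0..<r}" by simp
  then obtain a where "a < r" "p a = b"
    using assms(1) permutes_image[OF p] by (metis atLeastLessThan_iff imageE zero_le)
  then have "(\<Prod>a\<in>{0..<r}. R (i a) (j (p a))) = 0"
    using assms by (intro prod_zero bexI[of _ a]) auto
  then show "signof p * (\<Prod>a\<in>{0..<r}. R (i a) (j (p a))) = 0" by simp
qed

lemma minor_unitriangular:
  assumes "\<And>a. a < r \<Longrightarrow> R (i a) (j a) = 1"
    and "\<And>a b. a < r \<Longrightarrow> b < a \<Longrightarrow> R (i a) (j b) = 0"
  shows "minor R r i j = 1"
proof -
  let ?A = "mat r r (\<lambda>(a, b). R (i a) (j b))"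
  have "minor R r i j = prod_list (diag_mat ?A)"
    unfolding minor_def
    by (rule det_upper_triangular[of _ r]) (use assms in \<open>auto intro!: upper_triangularI\<close>)
  also have "diag_mat ?A = map (\<lambda>_. 1) [0..<r]"
    using assms by (auto simp: diag_mat_def intro!: map_cong)
  finally show ?thesis by (simp add: prod_list_replicate map_replicate_const)
qed

lemma tendsto_minor:
  assumes "\<And>i c. (\<lambda>m. R m i c) \<longlonglongrightarrow> R' i c"
  shows "(\<lambda>m. minor (R m) r i j) \<longlonglongrightarrow> minor R' r i j"
  unfolding minor_Leibniz by (intro tendsto_intros assms)

section \<open>Total nonnegativity and bidiagonal factors\<close>

definition totally_nonneg :: "(nat \<Rightarrow> nat \<Rightarrow> real) \<Rightarrow> bool" where
  "totally_nonneg R \<longleftrightarrow> (\<forall>r i j. strict_mono_on {..<r} i \<longrightarrow> strict_mono_on {..<r} j \<longrightarrow>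
     minor R r i j \<ge> 0)"

lemma minor_nonneg_mono:
  assumes R: "totally_nonneg R" and j: "strict_mono_on {..<r} j"
    and i: "\<And>a b. a < b \<Longrightarrow> b < r \<Longrightarrow> i a \<le> i b"
  shows "minor R r i j \<ge> 0"
proof (cases "strict_mono_on {..<r} i")
  case True
  with R j show ?thesis by (simp add: totally_nonneg_def)
next
  case False
  then obtain a b where "a < b" "b < r" "\<not> i a < i b"
    by (auto simp: strict_mono_on_def)
  with i[of a b] have "a < r" "b < r" "a \<noteq> b" "i a = i b" by auto
  then show ?thesis by (subst minor_eq_rows[of a _ b]) auto
qed

text \<open>
  In the expansion the row choices increase weakly, so that every term is a minor
  of \<open>R'\<close> or has a repeated row.
\<close>

context
  fixes R R' :: "nat \<Rightarrow> nat \<Rightarrow> real" and c :: real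
  assumes R: "\<And>i x. R i x = R' (if even i then Suc i else i) x + (if odd i then c else 0) * R' (Suc i) x"
    and c: "c \<ge> 0" and R': "totally_nonneg R'"
begin

text \<open>All terms of the expansion are nonnegative, so each single one is a lower bound. A
  nonempty \<open>S\<close> will serve for strict positivity.\<close>

lemma bidiagonal_minor_ge:
  assumes i: "strict_mono_on {..<r} i" and j: "strict_mono_on {..<r} j" and S: "S \<subseteq> {0..<r}"
  shows "minor R r i j \<ge> (\<Prod>a\<in>S. if odd (i a) then c else 0) *
    minor R' r (\<lambda>a. if a \<in> S \<or> even (i a) then Suc (i a) else i a) j"
proof -
  let ?T = "\<lambda>S. (\<Prod>a\<in>S. if odd (i a) then c else 0) *
    minor R' r (\<lambda>a. if a \<in> S then Suc (i a) else if even (i a) then Suc (i a) else i a) j"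
  have nonneg: "?T S \<ge> 0" for S
  proof (intro mult_nonneg_nonneg prod_nonneg minor_nonneg_mono[OF R' j])
    fix a b assume "a < b" "b < r"
    \<comment> \<open>Each row index moves up by at most one, so strict order becomes at worst weak
      order.\<close>
    then have "i a < i b" using i by (auto simp: strict_mono_on_def)
    then show "(if a \<in> S then Suc (i a) else if even (i a) then Suc (i a) else i a) \<le>
        (if b \<in> S then Suc (i b) else if even (i b) then Suc (i b) else i b)"
      by auto
  qed (use c in auto)
  have "?T S \<le> sum ?T (Pow {0..<r})"
    using S nonneg by (intro member_le_sum) auto
  also have "\<dots> = minor R r i j"
    by (rule minor_expand[symmetric, OF R])
  also have "(\<lambda>a. if a \<in> S then Suc (i a) else if even (i a) then Suc (i a) else i a)
    = (\<lambda>a. if a \<in> S \<or> even (i a) then Suc (i a) else i a)" by auto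
  finally show ?thesis .
qed

lemma bidiagonal_totally_nonneg: "totally_nonneg R"
  unfolding totally_nonneg_def
proof (intro allI impI)
  fix r and i j :: "nat \<Rightarrow> nat" assume ij: "strict_mono_on {..<r} i" "strict_mono_on {..<r} j"
  \<comment> \<open>The term of the empty set has weight 1, the empty product.\<close>
  have "0 \<le> minor R' r (\<lambda>a. if a \<in> {} \<or> even (i a) then Suc (i a) else i a) j"
  proof (rule minor_nonneg_mono[OF R' ij(2)])
    fix a b assume "a < b" "b < r"
    then have "i a < i b" using ij by (auto simp: strict_mono_on_def)
    then show "(if a \<in> {} \<or> even (i a) then Suc (i a) else i a) \<le>
        (if b \<in> {} \<or> even (i b) then Suc (i b) else i b)"
      by auto
  qed
  also have "\<dots> \<le> minor R r i j"
    using bidiagonal_minor_ge[OF ij, of "{}"] by simp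
  finally show "0 \<le> minor R r i j" .
qed

end

section \<open>Hurwitz matrices of two power series\<close>

text \<open>Row \<open>2 * s\<close> lists the coefficients of \<open>z\<^sup>s u\<close>, and row \<open>2 * s + 1\<close> those of \<open>z\<^sup>s v\<close>.\<close>

definition hurwitz :: "(nat \<Rightarrow> real) \<Rightarrow> (nat \<Rightarrow> real) \<Rightarrow> nat \<Rightarrow> nat \<Rightarrow> real" where
  "hurwitz u v i x = (if x < i div 2 then 0 else (if even i then u else v) (x - i div 2))"

text \<open>The hypotheses say \<open>v = u + c z w\<close>. In \<open>hurwitz w u\<close>, row
  \<open>2 * s + 1\<close> is \<open>z^s u\<close> and row \<open>2 * s + 2\<close> is
  \<open>z^(s+1) w\<close>; hence \<open>z^s u\<close> is a single row there and
  \<open>z^s v\<close> combines two adjacent ones.\<close>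

lemma hurwitz_step:
  assumes "v 0 = u 0" and "\<And>n. v (Suc n) = u (Suc n) + c * w n"
  shows "hurwitz u v i x = hurwitz w u (if even i then Suc i else i) x +
    (if odd i then c else 0) * hurwitz w u (Suc i) x"
proof (cases "even i")
  case True
  then show ?thesis by (auto simp: hurwitz_def)
next
  case False
  then obtain k where k: "i = Suc (2 * k)" by (auto elim: oddE)
  consider "x < k" | "x = k" | n where "x = k + Suc n"
    by (metis less_imp_Suc_add linorder_neqE_nat add_Suc_right)
  then show ?thesis using k assms by cases (auto simp: hurwitz_def)
qed

text \<open>Rows \<open>2 * s\<close> and \<open>2 * s + 1\<close> are both the unit vector at
  \<open>s\<close>, so a minor is either that of an identity matrix or zero.\<close>

lemma totally_nonneg_hurwitz_one:
  assumes "\<And>n. u n = (if n = 0 then 1 else 0)"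
  shows "totally_nonneg (hurwitz u u)"
  unfolding totally_nonneg_def
proof (intro allI impI)
  fix r and i j :: "nat \<Rightarrow> nat"
  assume i: "strict_mono_on {..<r} i" and j: "strict_mono_on {..<r} j"
  have H: "hurwitz u u k x = (if x = k div 2 then 1 else 0)" for k x
    by (auto simp: hurwitz_def assms)
  have jlt: "j a < j b" if "a < b" "b < r" for a b
    using j that by (auto simp: strict_mono_on_def)
  have ile: "i a div 2 \<le> i b div 2" if "a \<le> b" "b < r" for a b
    using strict_mono_onD[OF i, of a b] that by (cases "a = b") (auto intro!: div_le_mono)
  show "0 \<le> minor (hurwitz u u) r i j"
  proof (cases "\<forall>a<r. j a = i a div 2")
    case True
    have "minor (hurwitz u u) r i j = 1"
    proof (rule minor_unitriangular)
      show "hurwitz u u (i a) (j b) = 0" if "a < r" "b < a" for a b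
        using True jlt[of b a] that by (simp add: H)
    qed (use True in \<open>simp add: H\<close>)
    then show ?thesis by simp
  next
    case False
    define a where "a = (LEAST a. a < r \<and> j a \<noteq> i a div 2)"
    have a: "a < r" "j a \<noteq> i a div 2"
      using LeastI_ex[of "\<lambda>a. a < r \<and> j a \<noteq> i a div 2"] False by (auto simp: a_def)
    have lt: "j b = i b div 2" if "b < a" for b
      using not_less_Least[of b "\<lambda>a. a < r \<and> j a \<noteq> i a div 2"] that a by (auto simp: a_def)
    have "minor (hurwitz u u) r i j = 0"
    \<comment> \<open>At the first mismatch \<open>a\<close>, if the 1 of row \<open>a\<close> lies
      left of column \<open>j a\<close>, it either hits an earlier selected column, giving equal
      rows, or is missed altogether, giving a zero row. Otherwise column \<open>j a\<close> is
      zero.\<close>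
    proof (cases "i a div 2 < j a")
      case True
      show ?thesis
      proof (cases "\<exists>b<a. i b div 2 = i a div 2")
        case True
        then obtain b where "b < a" "i b div 2 = i a div 2" by blast
        then show ?thesis using a by (intro minor_eq_rows[of a _ b]) (auto simp: H)
      next
        case False
        show ?thesis
        proof (rule minor_zero_row[OF a(1)])
          fix b assume "b < r"
          consider "b < a" | "b = a" | "a < b" by linarith
          then show "hurwitz u u (i a) (j b) = 0"
            using False True lt jlt[of a b] \<open>b < r\<close> by cases (auto simp: H)
        qed
      qed
    next
      case F: False
      show ?thesis
      proof (rule minor_zero_col[OF a(1)])
        fix b assume "b < r"
        show "hurwitz u u (i b) (j a) = 0"
          using F a lt[of b] jlt[of b a] ile[of a b] \<open>b < r\<close> by (cases "b < a") (auto simp: H)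
      qed
    qed
    then show ?thesis by simp
  qed
qed

section \<open>The hypergeometric series 0F1(; t; z) and its contiguity relation\<close>

definition bessel_coeff :: "real \<Rightarrow> nat \<Rightarrow> real" where
  "bessel_coeff t n = 1 / (pochhammer t n * fact n)"

lemma bessel_coeff_0 [simp]: "bessel_coeff t 0 = 1"
  by (simp add: bessel_coeff_def)

text \<open>Both shifted coefficients are multiples of the same
  \<open>bessel_coeff t (Suc n)\<close>; the two factors add up to 1, which gives the contiguity
  relation.\<close>

lemma bessel_coeff_raise:
  assumes t: "t > 0"
  shows "bessel_coeff (t + 1) (Suc n) = bessel_coeff t (Suc n) * (t / (t + 1 + real n))"
    and "bessel_coeff (t + 2) n / (t * (t + 1)) =
      bessel_coeff t (Suc n) * (real (Suc n) / (t + 1 + real n))"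
proof -
  define P where "P = pochhammer (t + 1) n"
  define Y where "Y = t + 1 + real n"
  have pos: "P > 0" "Y > 0" using t by (auto intro!: pochhammer_pos simp: P_def Y_def)
  have 0: "bessel_coeff t (Suc n) = 1 / (t * P * (real (Suc n) * fact n))"
    by (simp add: bessel_coeff_def pochhammer_rec P_def)
  have 1: "pochhammer (t + 1) (Suc n) = P * Y"
    by (simp add: pochhammer_Suc P_def Y_def)
  have "pochhammer (t + 1) (Suc n) = (t + 1) * pochhammer (t + 2) n"
    by (simp add: pochhammer_rec add.assoc)
  with 1 have 2: "pochhammer (t + 2) n = P * Y / (t + 1)"
    using t by (simp add: eq_divide_eq mult.commute)
  have "bessel_coeff (t + 1) (Suc n) = 1 / (P * Y * (real (Suc n) * fact n))"
    unfolding bessel_coeff_def 1 by simp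
  then show "bessel_coeff (t + 1) (Suc n) = bessel_coeff t (Suc n) * (t / (t + 1 + real n))"
    unfolding 0 Y_def[symmetric] using t pos by simp
  have "bessel_coeff (t + 2) n / (t * (t + 1)) = 1 / (t * P * Y * fact n)"
    unfolding bessel_coeff_def 2 using t by simp
  then show "bessel_coeff (t + 2) n / (t * (t + 1)) =
      bessel_coeff t (Suc n) * (real (Suc n) / (t + 1 + real n))"
    unfolding 0 Y_def[symmetric] using t pos by (simp del: of_nat_Suc)
qed

lemma bessel_coeff_contiguous:
  assumes "t > 0"
  shows "bessel_coeff t (Suc n) = bessel_coeff (t + 1) (Suc n) + 1 / (t * (t + 1)) * bessel_coeff (t + 2) n"
proof -
  have "t / (t + 1 + real n) + real (Suc n) / (t + 1 + real n) = 1"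
    using assms by (simp flip: add_divide_distrib)
  then have "bessel_coeff t (Suc n) =
      bessel_coeff t (Suc n) * (t / (t + 1 + real n) + real (Suc n) / (t + 1 + real n))"
    by simp
  also have "\<dots> = bessel_coeff (t + 1) (Suc n) + bessel_coeff (t + 2) n / (t * (t + 1))"
    unfolding bessel_coeff_raise[OF assms] by (rule distrib_left)
  finally show ?thesis by simp
qed

section \<open>Convergents of the continued fraction\<close>

text \<open>
  Coefficients of the convergents of the Gauss continued fraction (modified Lommel polynomials);
  \<open>m - n - i\<close> is truncated, which makes them vanish for \<open>m < 2 * n\<close>.
\<close>

definition lommel_coeff :: "nat \<Rightarrow> real \<Rightarrow> nat \<Rightarrow> real" where
  "lommel_coeff m t n =
     bessel_coeff t n * (\<Prod>i<n. real (m - n - i) / (t + real (m - n) + real i))"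

lemma lommel_coeff_0 [simp]: "lommel_coeff m t 0 = 1"
  by (simp add: lommel_coeff_def)

lemma lommel_coeff_small: "m < 2 * n \<Longrightarrow> lommel_coeff m t n = 0"
proof -
  assume "m < 2 * n"
  then have "m - n < n" "m - n - (m - n) = 0" by auto
  then show ?thesis unfolding lommel_coeff_def by (auto intro!: bexI[of _ "m - n"])
qed

text \<open>The contiguity relation survives truncation if the order \<open>m\<close> drops by one
  whenever \<open>t\<close> grows by one.\<close>

lemma lommel_coeff_rec:
  assumes t: "t > 0"
  shows "lommel_coeff (Suc (Suc m)) t (Suc n) =
    lommel_coeff (Suc m) (t + 1) (Suc n) + 1 / (t * (t + 1)) * lommel_coeff m (t + 2) n"
\<comment> \<open>Here all three terms vanish; in the other case \<open>n \<le> N\<close>, so no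
  subtraction is truncated.\<close>
proof (cases "m < 2 * n")
  case True
  then show ?thesis by (simp add: lommel_coeff_small)
next
  case False
  define N where "N = m - n"
  define Q where "Q = (\<Prod>i<n. real (N - i))"
  define D where "D = (\<Prod>i<n. t + 2 + real N + real i)"
  define b where "b = bessel_coeff t (Suc n)"
  have N: "n \<le> N" "Suc (Suc m) - Suc n = Suc N" "Suc m - Suc n = N"
    using False by (auto simp: N_def)
  have "(\<Prod>i<Suc n. real (Suc N - i)) = real (Suc N) * Q"
    unfolding Q_def by (subst prod.lessThan_Suc_shift) simp
  moreover have "(\<Prod>i<Suc n. t + real (Suc N) + real i) = (t + 1 + N) * D"
    unfolding D_def by (subst prod.lessThan_Suc_shift) (simp add: add_ac)
  ultimately have 1: "lommel_coeff (Suc (Suc m)) t (Suc n) = b * (real (Suc N) * Q / ((t + 1 + N) * D))"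
    unfolding lommel_coeff_def N b_def by (simp add: prod_dividef del: prod.lessThan_Suc)
  have "(\<Prod>i<Suc n. real (N - i)) = Q * (real N - real n)"
    unfolding Q_def using N by (simp add: of_nat_diff)
  moreover have "(\<Prod>i<Suc n. t + 1 + real N + real i) = (t + 1 + N) * D"
    unfolding D_def by (subst prod.lessThan_Suc_shift) (simp add: add_ac)
  ultimately have 2: "lommel_coeff (Suc m) (t + 1) (Suc n) =
      b * (t / (t + 1 + n)) * (Q * (real N - real n) / ((t + 1 + N) * D))"
    unfolding lommel_coeff_def N b_def bessel_coeff_raise(1)[OF t]
    by (simp add: prod_dividef del: prod.lessThan_Suc)
  have 3: "1 / (t * (t + 1)) * lommel_coeff m (t + 2) n = b * (real (Suc n) / (t + 1 + n)) * (Q / D)"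
  proof -
    have "lommel_coeff m (t + 2) n = bessel_coeff (t + 2) n * (Q / D)"
      by (simp add: lommel_coeff_def Q_def D_def N_def prod_dividef)
    then have "1 / (t * (t + 1)) * lommel_coeff m (t + 2) n =
        bessel_coeff (t + 2) n / (t * (t + 1)) * (Q / D)" by simp
    then show ?thesis unfolding bessel_coeff_raise(2)[OF t] b_def .
  qed
  \<comment> \<open>After removal of the common factor \<open>b * (Q / D)\<close>, the recurrence is
    this identity with \<open>x = N + 1\<close> and \<open>y = n + 1\<close>.\<close>
  have ratio: "x / X = t / Y * ((x - y) / X) + y / Y" if "X = t + x" "Y = t + y" "X > 0" "Y > 0"
    for x y X Y :: real
    using that(3,4) by (simp add: divide_simps) (simp add: that(1,2) algebra_simps)
  have "real (Suc N) / (t + 1 + N) =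
      t / (t + 1 + n) * ((real N - real n) / (t + 1 + N)) + real (Suc n) / (t + 1 + n)"
    using ratio[of "t + 1 + N" "real (Suc N)" "t + 1 + n" "real (Suc n)"] t by simp
  then have "b * (Q / D) * (real (Suc N) / (t + 1 + N)) =
      b * (Q / D) * (t / (t + 1 + n) * ((real N - real n) / (t + 1 + N)) + real (Suc n) / (t + 1 + n))"
    by (rule arg_cong)
  also have "\<dots> = b * (Q / D) * (t / (t + 1 + n) * ((real N - real n) / (t + 1 + N))) +
      b * (Q / D) * (real (Suc n) / (t + 1 + n))"
    by (rule distrib_left)
  finally show ?thesis unfolding 1 2 3 by (simp only: times_divide_times_eq mult_ac)
qed

lemma lommel_coeff_tendsto:
  assumes "t > 0"
  shows "(\<lambda>m. lommel_coeff m t n) \<longlonglongrightarrow> bessel_coeff t n"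
proof -
  have "(\<lambda>m. real (m - n - i) / (t + real (m - n) + real i)) \<longlonglongrightarrow> 1" for i
  proof -
    define c where "c = t + 2 * real i"
    have "filterlim (\<lambda>m. c + real m) at_infinity sequentially"
      by (intro filterlim_at_top_imp_at_infinity filterlim_tendsto_add_at_top[OF tendsto_const]
          filterlim_real_sequentially)
    from tendsto_diff[OF tendsto_const tendsto_divide_0[OF tendsto_const this], of 1 c]
    have "(\<lambda>m. 1 - c / (c + real m)) \<longlonglongrightarrow> 1" by simp
    moreover have "1 - c / (c + real m) = real m / (t + real (m + i) + real i)" for m
    proof -
      have "c + real m > 0" "t + real (m + i) + real i = c + real m"
        using assms by (auto simp: c_def)
      then show ?thesis by (simp add: field_simps)
    qed
    ultimately have "(\<lambda>m. real m / (t + real (m + i) + real i)) \<longlonglongrightarrow> 1" by simp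
    \<comment> \<open>Shifting the index by \<open>n + i\<close> makes the natural subtractions
      exact.\<close>
    then have "(\<lambda>m. real (m + (n + i) - n - i) / (t + real (m + (n + i) - n) + real i)) \<longlonglongrightarrow> 1"
      by simp
    then show ?thesis by (rule LIMSEQ_offset)
  qed
  then have "(\<lambda>m. \<Prod>i<n. real (m - n - i) / (t + real (m - n) + real i)) \<longlonglongrightarrow> (\<Prod>i<n. 1)"
    by (intro tendsto_prod)
  then show ?thesis
    unfolding lommel_coeff_def using tendsto_mult[OF tendsto_const] by fastforce
qed

text \<open>The recurrence gives a bidiagonal step that lowers \<open>m\<close> and raises
  \<open>t\<close> by one; at \<open>m = 0\<close> both series are the constant 1.\<close>

lemma totally_nonneg_lommel:
  "t > 0 \<Longrightarrow> totally_nonneg (hurwitz (lommel_coeff m (t + 1)) (lommel_coeff (Suc m) t))"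
proof (induction m arbitrary: t)
  case 0
  have "lommel_coeff (Suc 0) s n = (if n = 0 then 1 else 0)"
    "lommel_coeff 0 s n = (if n = 0 then 1 else 0)" for s n
    by (cases "n = 0"; simp add: lommel_coeff_small)+
  then have "lommel_coeff 0 (t + 1) = lommel_coeff (Suc 0) t"
    "\<And>n. lommel_coeff (Suc 0) t n = (if n = 0 then 1 else 0)" by auto
  then show ?case using totally_nonneg_hurwitz_one by metis
next
  case (Suc m)
  have "totally_nonneg (hurwitz (lommel_coeff m (t + 2)) (lommel_coeff (Suc m) (t + 1)))"
    using Suc.IH[of "t + 1"] Suc.prems by (simp add: add.assoc)
  then show ?case
    using Suc.prems
    by (intro bidiagonal_totally_nonneg[OF hurwitz_step[where c = "1 / (t * (t + 1))"]])
      (auto simp: lommel_coeff_rec)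
qed

section \<open>The limit matrix and strict positivity of its minors\<close>

definition bessel_matrix :: "real \<Rightarrow> nat \<Rightarrow> nat \<Rightarrow> real" where
  "bessel_matrix t = hurwitz (bessel_coeff (t + 1)) (bessel_coeff t)"

text \<open>Minors are continuous in the entries, so nonnegativity passes to the limit; strict
  positivity needs a separate argument.\<close>

lemma totally_nonneg_bessel:
  assumes "t > 0"
  shows "totally_nonneg (bessel_matrix t)"
  unfolding totally_nonneg_def
proof (intro allI impI)
  fix r and i j :: "nat \<Rightarrow> nat" assume ij: "strict_mono_on {..<r} i" "strict_mono_on {..<r} j"
  let ?L = "\<lambda>m. hurwitz (lommel_coeff m (t + 1)) (lommel_coeff (Suc m) t)"
  have "(\<lambda>m. ?L m k x) \<longlonglongrightarrow> bessel_matrix t k x" for k x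
    using lommel_coeff_tendsto[of "t + 1"] LIMSEQ_Suc[OF lommel_coeff_tendsto[of t]] assms
    by (auto simp: hurwitz_def bessel_matrix_def)
  then have "(\<lambda>m. minor (?L m) r i j) \<longlonglongrightarrow> minor (bessel_matrix t) r i j"
    by (rule tendsto_minor)
  moreover have "minor (?L m) r i j \<ge> 0" for m
    using totally_nonneg_lommel[OF assms, of m] ij by (auto simp: totally_nonneg_def)
  ultimately show "minor (bessel_matrix t) r i j \<ge> 0"
    by (intro LIMSEQ_le_const) auto
qed

lemma bessel_matrix_step:
  assumes "t > 0"
  shows "bessel_matrix t i x = bessel_matrix (t + 1) (if even i then Suc i else i) x +
    (if odd i then 1 / (t * (t + 1)) else 0) * bessel_matrix (t + 1) (Suc i) x"
proof -
  have "t + 1 + 1 = t + 2" by simp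
  show ?thesis
    unfolding bessel_matrix_def \<open>t + 1 + 1 = t + 2\<close>
    by (rule hurwitz_step) (simp, rule bessel_coeff_contiguous[OF assms])
qed

text \<open>Two contiguity steps: the first, with \<open>S = {k}\<close>, moves only row
  \<open>k\<close>, to an even index; the second, with \<open>S = {}\<close>, moves that row on to
  the next odd index.\<close>

lemma bessel_minor_shift:
  assumes t: "t > 0" and s: "strict_mono_on {..<r} s" and j: "strict_mono_on {..<r} j"
    and k: "k < r" and s': "strict_mono_on {..<r} (s(k := Suc (s k)))"
  shows "minor (bessel_matrix t) r (\<lambda>a. 2 * s a + 1) j \<ge>
    1 / (t * (t + 1)) * minor (bessel_matrix (t + 2)) r (\<lambda>a. 2 * (s(k := Suc (s k))) a + 1) j"
proof -
  let ?i = "\<lambda>a. 2 * s a + 1" and ?i' = "\<lambda>a. if a = k then 2 * s a + 2 else 2 * s a + 1"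
  have i: "strict_mono_on {..<r} ?i" using s by (auto simp: strict_mono_on_def)
  have i': "strict_mono_on {..<r} ?i'"
  proof (rule strict_mono_onI)
    fix a b assume "a \<in> {..<r}" "b \<in> {..<r}" "a < b"
    then have "s a < s b" "(s(k := Suc (s k))) a < (s(k := Suc (s k))) b"
      using s s' by (auto simp: strict_mono_on_def simp del: fun_upd_apply)
    then show "?i' a < ?i' b" by (auto split: if_splits)
  qed
  have tn: "totally_nonneg (bessel_matrix (t + 1))" "totally_nonneg (bessel_matrix (t + 1 + 1))"
    using t by (auto intro!: totally_nonneg_bessel)
  have 1: "minor (bessel_matrix t) r ?i j \<ge>
    1 / (t * (t + 1)) * minor (bessel_matrix (t + 1)) r ?i' j"
  proof -
    have "(\<lambda>a. if a \<in> {k} \<or> even (?i a) then Suc (?i a) else ?i a) = ?i'" by auto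
    then show ?thesis
      using bidiagonal_minor_ge[OF bessel_matrix_step[OF t] _ tn(1) i j, of "{k}"] k t by simp
  qed
  have 2: "minor (bessel_matrix (t + 1)) r ?i' j \<ge>
    minor (bessel_matrix (t + 2)) r (\<lambda>a. 2 * (s(k := Suc (s k))) a + 1) j"
  proof -
    have "(\<lambda>a. if a \<in> {} \<or> even (?i' a) then Suc (?i' a) else ?i' a) =
        (\<lambda>a. 2 * (s(k := Suc (s k))) a + 1)" by (auto simp: fun_eq_iff)
    then show ?thesis
      using bidiagonal_minor_ge[OF bessel_matrix_step[of "t + 1"] _ tn(2) i' j, of "{}"] t
      by (simp add: add.assoc)
  qed
  have "1 / (t * (t + 1)) \<ge> 0" using t by simp
  from order_trans[OF mult_left_mono[OF 2 this] 1] show ?thesis .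
qed

text \<open>Induction on the number of boxes: \<open>j a - s a\<close> is the length of row
  \<open>a\<close> of the skew shape.\<close>

lemma bessel_minor_pos:
  assumes "t > 0" "strict_mono_on {..<r} s" "strict_mono_on {..<r} j"
    and "\<And>a. a < r \<Longrightarrow> s a \<le> j a"
  shows "minor (bessel_matrix t) r (\<lambda>a. 2 * s a + 1) j > 0"
  using assms
proof (induction "\<Sum>a<r. j a - s a" arbitrary: t s rule: less_induct)
  case less
  show ?case
  proof (cases "\<forall>a<r. s a = j a")
    case True
    have "minor (bessel_matrix t) r (\<lambda>a. 2 * s a + 1) j = 1"
      by (rule minor_unitriangular)
        (use True less.prems in \<open>auto simp: bessel_matrix_def hurwitz_def strict_mono_on_def\<close>)
    then show ?thesis by simp
  next
    case False
    \<comment> \<open>For the last nonempty row, raising \<open>s k\<close> keeps \<open>s\<close>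
      strictly increasing: \<open>s k + 1 \<le> j k < j b = s b\<close> for every later
      \<open>b\<close>.\<close>
    define k where "k = Max {a. a < r \<and> s a \<noteq> j a}"
    have "k \<in> {a. a < r \<and> s a \<noteq> j a}"
      unfolding k_def using False by (intro Max_in) auto
    then have k: "k < r" "s k < j k" using less.prems(4)[of k] by auto
    have gt: "s a = j a" if "k < a" "a < r" for a
      using Max_ge[of "{a. a < r \<and> s a \<noteq> j a}" a] that unfolding k_def by fastforce
    let ?s = "s(k := Suc (s k))"
    have s': "strict_mono_on {..<r} ?s"
    proof (rule strict_mono_onI)
      fix a b assume ab: "a \<in> {..<r}" "b \<in> {..<r}" "a < b"
      then have "s a < s b" "j a < j b"
        using less.prems by (auto simp: strict_mono_on_def)
      then show "?s a < ?s b" using gt[of b] k ab by auto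
    qed
    have "(\<Sum>a<r. j a - ?s a) < (\<Sum>a<r. j a - s a)"
      using k by (intro sum_strict_mono_ex1) auto
    then have "minor (bessel_matrix (t + 2)) r (\<lambda>a. 2 * ?s a + 1) j > 0"
    proof (intro less.hyps)
      show "?s a \<le> j a" if "a < r" for a using less.prems(4)[OF that] k by simp
    qed (rule s' | use less.prems in simp)+
    then have "0 < 1 / (t * (t + 1)) * minor (bessel_matrix (t + 2)) r (\<lambda>a. 2 * ?s a + 1) j"
      using less.prems(1) by simp
    also have "\<dots> \<le> minor (bessel_matrix t) r (\<lambda>a. 2 * s a + 1) j"
      using less.prems k s' by (intro bessel_minor_shift) auto
    finally show ?thesis .
  qed
qed

section \<open>Jacobi-Trudi determinants as minors of the limit matrix\<close>

theorem theorem3p1: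
  fixes t :: real and \<phi> :: "symfun \<Rightarrow> real"
  assumes "t > 0"
    and "real_algebra_hom \<phi>"
    and "\<And>n. \<phi> (complete_sym n) = 1 / (pochhammer t n * fact n)"
    and "is_skew_partition lam mu"
  shows "\<phi> (skew_schur lam mu) > 0"
proof -
  interpret comm_ring_hom \<phi>
    using assms(2) unfolding real_algebra_hom_def
    by unfold_locales (auto simp: linear_add linear_0)
  \<comment> \<open>Row and column positions are negated and shifted by \<open>M\<close> to be natural and increasing.\<close>
  define r where "r = length lam"
  define M where "M = (if r = 0 then 0 else lam ! 0)"
  define s where "s a = M + a - lam ! a" for a
  define j where "j a = M + a - mu ! a" for a
  have lam: "lam ! b \<le> lam ! a" "mu ! b \<le> mu ! a" if "a < b" "b < r" for a b
    using assms(4) that unfolding is_skew_partition_def is_partition_def r_def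
    by (auto simp: sorted_wrt_iff_nth_less)
  have mu: "mu ! a \<le> lam ! a" if "a < r" for a
    using assms(4) that by (auto simp: is_skew_partition_def r_def)
  have M: "lam ! a \<le> M" if "a < r" for a
    using lam(1)[of 0 a] that by (cases "a = 0") (auto simp: M_def)
  have entry: "\<phi> (complete_sym_int (int (lam ! a) - int (mu ! b) - int a + int b)) =
      bessel_matrix t (2 * s a + 1) (j b)" if "a < r" "b < r" for a b
  proof -
    \<comment> \<open>The entry is the coefficient of \<open>z^(j b)\<close> in
      \<open>z^(s a) H t\<close>; the convention for negative indices matches the zeros for
      \<open>j b < s a\<close>.\<close>
    have eq: "int (lam ! a) - int (mu ! b) - int a + int b = int (j b) - int (s a)"
      using M[of a] M[of b] mu[of b] that by (simp add: s_def j_def of_nat_diff)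
    show ?thesis unfolding eq
      using assms(2,3)
      by (auto simp: complete_sym_int_def bessel_matrix_def hurwitz_def bessel_coeff_def
          nat_diff_distrib)
  qed
  have "\<phi> (skew_schur lam mu) = det (map_mat \<phi> (mat r r
      (\<lambda>(a, b). complete_sym_int (int (lam ! a) - int (mu ! b) - int a + int b))))"
    by (simp add: skew_schur_def r_def)
  also have "\<dots> = minor (bessel_matrix t) r (\<lambda>a. 2 * s a + 1) j"
    unfolding minor_def by (intro arg_cong[where f = det] eq_matI) (auto simp: entry)
  also have "\<dots> > 0"
  proof (rule bessel_minor_pos[OF assms(1)])
    show "strict_mono_on {..<r} s"
    proof (rule strict_mono_onI)
      fix a b assume "a \<in> {..<r}" "b \<in> {..<r}" "a < b"
      then show "s a < s b" using lam(1)[of a b] M[of a] by (simp add: s_def)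
    qed
    show "strict_mono_on {..<r} j"
    proof (rule strict_mono_onI)
      fix a b assume "a \<in> {..<r}" "b \<in> {..<r}" "a < b"
      then show "j a < j b" using lam(2)[of a b] M[of a] mu[of a] by (simp add: j_def)
    qed
    show "s a \<le> j a" if "a < r" for a
      using mu[OF that] by (simp add: s_def j_def)
  qed
  finally show ?thesis .
qed

end
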